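(* The function $M:[0,1]\times[0,1]\to\mathbb{R}$ constructed in the context is not of bounded variation (in the sense of Arzelà) on $[0,1]\times[0,1]$.
   Context: Construction of $M$. Let $a_0=0$ and $a_n=\frac12+\frac1{2^2}+\dots+\frac1{2^n}$ for $n\in\mathbb{N}$, so $a_n\uparrow1$. Let $\Theta(x,y)=x(x-0.5)y$ on $[0,0.5]\times[0,1]$, so $\Theta(0,y)=\Theta(0.5,y)$ for all $y\in[0,1]$. For $n\ge1$ let $\Upsilon_n:[a_{n-1},a_n]\to[0,0.5]$ be $\Upsilon_n(x)=2^{n-1}(x-a_{n-1})$. Let $G_1(x,y)=\Theta(x,y)$ for $(x,y)\in[0,0.5]\times[0,1]$, and for $n\ge2$ $$G_n(x,y)=\frac1n\Theta(\Upsilon_n(x),y)+\frac{n-1}{n}\Theta(0,y),\qquad (x,y)\in[a_{n-1},a_n]\times[0,1].$$ Let $F_n$ be the function on $[0,a_n]\times[0,1]$ obtained by gluing together $G_1,\dots,G_n$, and let $M(x,y)=\lim_{n\to\infty}F_n(x,y)$; that is, $M=G_n$ on $[a_{n-1},a_n]\times[0,1]$ for every $n\ge1$, extended continuously to $x=1$ by $M(1,y)=\Theta(0,y)=0$. Bounded variation in the sense of Arzelà: $g:[a,b]\times[c,d]\to\mathbb{R}$ is of bounded variation in the sense of Arzelà if the sums $\sum_{i=0}^{m-1}|g(x_{i+1},y_{i+1})-g(x_i,y_i)|$ are bounded uniformly over all finite sequences of points with $a=x_0\le x_1\le\dots\le x_m=b$ and $c=y_0\le y_1\le\dots\le y_m=d$.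 Equivalently, $g$ is the difference of two bounded functions each of which is nondecreasing in each variable separately. *)

theory Defs
  imports Complex_Main
begin

definition a_seq :: "nat \<Rightarrow> real" where
  "a_seq n = (\<Sum>k=1..n. 1 / 2 ^ k)"

definition Theta :: "real \<Rightarrow> real \<Rightarrow> real" where
  "Theta x y = x * (x - 1/2) * y"

text \<open>The pieces are written as total functions; \<open>Upsilon n\<close> and \<open>G n\<close> are meant for \<open>n \<ge> 1\<close> and
  first argument in \<open>[a\<^bsub>n-1\<^esub>, a\<^sub>n]\<close>.\<close>

definition Upsilon :: "nat \<Rightarrow> real \<Rightarrow> real" where
  "Upsilon n x = 2 ^ (n - 1) * (x - a_seq (n - 1))"

definition G :: "nat \<Rightarrow> real \<Rightarrow> real \<Rightarrow> real" where
  "G n x y =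
     (if n = 1 then Theta x y
      else 1 / real n * Theta (Upsilon n x) y + (real n - 1) / real n * Theta 0 y)"

text \<open>\<open>F n\<close> glues \<open>G 1, \<dots>, G n\<close> on \<open>[0, a\<^sub>n] \<times> [0, 1]\<close>; the index \<open>0\<close> only starts the recursion,
  so that \<open>F 1 = G 1\<close>. Values for \<open>x > a\<^sub>n\<close> are irrelevant: for \<open>x < 1\<close> the sequence
  \<open>F n x y\<close> is eventually constant.\<close>

primrec F :: "nat \<Rightarrow> real \<Rightarrow> real \<Rightarrow> real" where
  "F 0 x y = G 1 x y"
| "F (Suc n) x y = (if x \<le> a_seq n then F n x y else G (Suc n) x y)"

definition M :: "real \<Rightarrow> real \<Rightarrow> real" where
  "M x y = (if x < 1 then lim (\<lambda>n. F n x y) else Theta 0 y)"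

text \<open>A function on \<open>[a, b] \<times> [c, d]\<close> is given as a total function; only its values on the rectangle
  enter, since the points of a chain lie in it by monotonicity.\<close>

definition bv_arzela :: "(real \<Rightarrow> real \<Rightarrow> real) \<Rightarrow> real \<Rightarrow> real \<Rightarrow> real \<Rightarrow> real \<Rightarrow> bool" where
  "bv_arzela g a b c d \<longleftrightarrow>
     (\<exists>B. \<forall>(m::nat) (x::nat \<Rightarrow> real) (y::nat \<Rightarrow> real).
        x 0 = a \<and> x m = b \<and> (\<forall>i<m. x i \<le> x (Suc i)) \<and>
        y 0 = c \<and> y m = d \<and> (\<forall>i<m. y i \<le> y (Suc i)) \<longrightarrow>
        (\<Sum>i<m. \<bar>g (x (Suc i)) (y (Suc i)) - g (x i) (y i)\<bar>) \<le> B)"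

lemma a_seq_0 [simp]: "a_seq 0 = 0"
  by (simp add: a_seq_def)

lemma a_seq_Suc: "a_seq (Suc n) = a_seq n + 1 / 2 ^ Suc n"
  by (simp add: a_seq_def)

lemma a_seq_closed: "a_seq n = 1 - 1 / 2 ^ n"
  by (induction n) (simp_all add: a_seq_Suc field_simps)

lemma a_seq_less_1: "a_seq n < 1"
  by (simp add: a_seq_closed)

lemma a_seq_mono: "m \<le> n \<Longrightarrow> a_seq m \<le> a_seq n"
  by (simp add: a_seq_closed field_simps)

text \<open>Neighbouring pieces agree on the common edge.\<close>

lemma G_glue:
  assumes "n \<ge> 1"
  shows "G n (a_seq n) y = Theta 0 y" "G (Suc n) (a_seq n) y = Theta 0 y"
proof -
  have "Upsilon n (a_seq n) = 1 / 2"
    using assms by (cases n) (simp_all add: Upsilon_def a_seq_Suc)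
  moreover have "a_seq 1 = 1 / 2" by (simp add: a_seq_def)
  ultimately show "G n (a_seq n) y = Theta 0 y" by (simp add: G_def Theta_def)
  show "G (Suc n) (a_seq n) y = Theta 0 y"
    using assms by (simp add: G_def Theta_def Upsilon_def)
qed

lemma F_eq_G:
  assumes "1 \<le> k" "k \<le> n" "a_seq (k - 1) \<le> x" "x \<le> a_seq k"
  shows "F n x y = G k x y"
  using assms
proof (induction n arbitrary: k)
  case 0
  then show ?case by simp
next
  case (Suc n)
  show ?case
  proof (cases "k \<le> n")
    case True
    then have "x \<le> a_seq n" using Suc.prems a_seq_mono[of k n] by linarith
    then show ?thesis using Suc.IH[of k] Suc.prems True by simp
  next
    case False
    then have k: "k = Suc n" using Suc.prems by simp
    show ?thesis
    proof (cases "x \<le> a_seq n")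
      case True
      then have x: "x = a_seq n" using Suc.prems k by simp
      show ?thesis
      proof (cases "n = 0")
        case True
        then show ?thesis using x k by simp
      next
        case False
        then have "F n x y = G n x y"
          using Suc.IH[of n] x a_seq_mono[of "n - 1" n] by simp
        then show ?thesis using False x k G_glue[of n y] by simp
      qed
    qed (simp add: k)
  qed
qed

lemma M_eq_G:
  assumes "1 \<le> n" "a_seq (n - 1) \<le> x" "x \<le> a_seq n"
  shows "M x y = G n x y"
proof -
  have "(\<lambda>k. F k x y) \<longlonglongrightarrow> G n x y"
    using F_eq_G[of n] assms
    by (intro tendsto_eventually eventually_sequentiallyI[of n]) blast
  moreover have "x < 1" using assms a_seq_less_1[of n] by linarith
  ultimately show ?thesis by (simp add: M_def limI)
qed

lemma M_one: "M 1 y = 0"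
  by (simp add: M_def Theta_def)

end

theory Submission
  imports Defs "HOL-Analysis.Harmonic_Numbers"
begin

text \<open>
  The function \<^const>\<open>M\<close> vanishes on every common edge \<open>x = a\<^sub>k\<close> of two neighbouring pieces, while in
  the middle of the piece number \<open>n\<close> the parabola \<^const>\<open>Theta\<close>, compressed horizontally to that
  piece and scaled by \<open>1/n\<close>, has the value \<open>- y / (16 n)\<close> (lemmas \<open>M_edge\<close> and
  \<open>M_midpoint\<close>). Thus along the top side \<open>y = 1\<close> the function oscillates infinitely often, and
  crossing the piece \<open>n\<close> costs a variation of \<open>2 / (16 n)\<close>. The horizontal compression does not
  change this amount, so the first \<open>N\<close> pieces contribute one eighth of a partial harmonic sum,
  which is unbounded.

  A chain in the sense of Arzela has to start at \<open>(0, 0)\<close> and end at \<open>(1, 1)\<close>, but it may jump to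
  the top side in its very first step, move along it through edges and midpoints of the first \<open>N\<close>
  pieces, and finally jump to \<open>x = 1\<close>.
\<close>

lemma M_edge: "M (a_seq k) y = 0"
proof (cases "k = 0")
  case True
  then show ?thesis
    using M_eq_G[of 1 0 y] a_seq_mono[of 0 1] by (simp add: G_def Theta_def)
next
  case False
  then show ?thesis
    using M_eq_G[of k "a_seq k" y] a_seq_mono[of "k - 1" k] G_glue(1)[of k y]
    by (simp add: Theta_def)
qed

text \<open>The midpoint of a piece is sent by \<^const>\<open>Upsilon\<close> to \<open>1/4\<close>, the vertex of the parabola
  \<open>x (x - 1/2)\<close>, where it has the value \<open>- 1/16\<close>.\<close>

lemma M_midpoint: "M ((a_seq k + a_seq (Suc k)) / 2) y = - y / (16 * real (Suc k))"
proof -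
  let ?x = "(a_seq k + a_seq (Suc k)) / 2"
  have "M ?x y = G (Suc k) ?x y"
    using a_seq_mono[of k "Suc k"] by (intro M_eq_G) auto
  also have "\<dots> = Theta (1 / 4) y / real (Suc k)"
  proof (cases "k = 0")
    case True
    then have x: "?x = 1 / 4"
      by (simp add: a_seq_Suc)
    show ?thesis
      unfolding G_def x using True by simp
  next
    case False
    have u: "Upsilon (Suc k) ?x = 1 / 4"
      by (simp add: Upsilon_def a_seq_Suc field_simps)
    show ?thesis
      unfolding G_def u using False by (simp add: Theta_def)
  qed
  finally show ?thesis
    by (simp add: Theta_def)
qed

text \<open>The increasing enumeration of all edges (even indices) and midpoints (odd indices): for even
  \<open>j\<close> the two averaged edges coincide. With this form monotonicity needs no parity distinction.\<close>

definition grid_point :: "nat \<Rightarrow> real" where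
  "grid_point j = (a_seq (j div 2) + a_seq (Suc j div 2)) / 2"

lemma grid_point_mono: "grid_point j \<le> grid_point (Suc j)"
  using a_seq_mono[of "j div 2" "Suc (Suc j) div 2"]
  by (simp add: grid_point_def)

lemma grid_point_le_1: "grid_point j \<le> 1"
  using a_seq_less_1[of "j div 2"] a_seq_less_1[of "Suc j div 2"]
  by (simp add: grid_point_def)

lemma grid_point_0 [simp]: "grid_point 0 = 0"
  by (simp add: grid_point_def)

lemma M_grid_point_even: "M (grid_point (2 * k)) y = 0"
  by (simp add: grid_point_def M_edge)

lemma M_grid_point_odd: "M (grid_point (Suc (2 * k))) y = - y / (16 * real (Suc k))"
  using M_midpoint[of k y] by (simp add: grid_point_def)

text \<open>The first point lies on the bottom side, the height at which a chain has to start. This costs nothing, since \<^const>\<open>M\<close> vanishes on the whole left side.\<close>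

lemma variation_along_grid:
  fixes N :: nat
  defines "h \<equiv> \<lambda>i. M (grid_point i) (if i = 0 then 0 else 1)"
  shows "(\<Sum>i<2 * N. \<bar>h (Suc i) - h i\<bar>) = harm N / 8"
proof (induction N)
  case 0
  then show ?case by (simp add: harm_def)
next
  case (Suc N)
  have even: "h (2 * k) = 0" for k
    by (simp only: h_def M_grid_point_even)
  have odd: "h (Suc (2 * k)) = - 1 / (16 * real (Suc k))" for k
    using M_grid_point_odd[of k 1] by (simp add: h_def)
  have "h (Suc (Suc (2 * N))) = 0"
    using even[of "Suc N"] by simp
  then have "\<bar>h (Suc (2 * N)) - h (2 * N)\<bar> + \<bar>h (Suc (Suc (2 * N))) - h (Suc (2 * N))\<bar>
      = inverse (real (Suc N)) / 8"
    unfolding odd even by (simp add: field_simps)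
  then show ?case
    using Suc.IH by (simp add: harm_Suc add_divide_distrib)
qed

theorem theorem6p1: "\<not> bv_arzela M 0 1 0 1"
proof
  assume "bv_arzela M 0 1 0 1"
  then obtain B where B: "\<forall>(m::nat) (x::nat \<Rightarrow> real) (y::nat \<Rightarrow> real).
      x 0 = 0 \<and> x m = 1 \<and> (\<forall>i<m. x i \<le> x (Suc i)) \<and>
      y 0 = 0 \<and> y m = 1 \<and> (\<forall>i<m. y i \<le> y (Suc i)) \<longrightarrow>
      (\<Sum>i<m. \<bar>M (x (Suc i)) (y (Suc i)) - M (x i) (y i)\<bar>) \<le> B"
    unfolding bv_arzela_def ..
  have bounded: "harm N \<le> 8 * B" for N
  proof -
    define x where "x i = (if i \<le> 2 * N then grid_point i else 1)" for i
    define y :: "nat \<Rightarrow> real" where "y i = (if i = 0 then 0 else 1)" for i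
    let ?v = "\<lambda>i. \<bar>M (x (Suc i)) (y (Suc i)) - M (x i) (y i)\<bar>"
    have "harm N / 8 = (\<Sum>i<2 * N. ?v i)"
      unfolding variation_along_grid[symmetric]
      by (intro sum.cong) (auto simp: x_def y_def)
    also have "\<dots> \<le> (\<Sum>i<Suc (2 * N). ?v i)"
      \<comment> \<open>The extra step is the jump to the corner \<open>(1, 1)\<close>, where the chain has to end.\<close>
      by simp
    also have "\<dots> \<le> B"
      by (rule B[rule_format, of x _ y]) (auto simp: x_def y_def grid_point_mono grid_point_le_1)
    finally show ?thesis by simp
  qed
  obtain N :: nat where "exp (8 * B) < real N"
    using reals_Archimedean2 by blast
  then have "exp (8 * B) < real N + 1"
    by simp
  then have "8 * B < ln (real N + 1)"
    by (metis exp_gt_zero exp_less_cancel_iff exp_ln less_trans)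
  also have "\<dots> \<le> harm N"
    by (rule ln_le_harm)
  finally show False
    using bounded[of N] by simp
qed

end
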